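(* Let $a,b,R$ be reals such that $0<a<1$, $b>0$, $R\geq 1$. Let $c:=e^{\pi/b}$. Then $$\int_R^\infty h(t,a,b)\,dt=\int_R^{cR}\frac{t^{a-1}}{e^t+1}\,dt$$ and $$(c-1)\frac{c^{a-1}R^a}{e^{cR}+1}<\int_R^\infty h(t,a,b)\,dt<(c-1)\frac{R^a}{e^R+1}.$$
   Context: For real $t>0$, $$h(t,a,b):=\frac{t^{a-1}}{e^t+1}-\frac{t^{a-1}e^{a\pi/b}}{e^{te^{\pi/b}}+1}.$$ *)

theory Defs
  imports "HOL-Analysis.Analysis"
begin

(* Meaningful for t > 0 only. *)
definition h :: "real \<Rightarrow> real \<Rightarrow> real \<Rightarrow> real" where
  "h t a b = t powr (a - 1) / (exp t + 1)
           - t powr (a - 1) * exp (a * pi / b) / (exp (t * exp (pi / b)) + 1)"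

end

theory Submission
  imports Defs
begin

text \<open>
  Write \<open>f t = t powr (a - 1) / (exp t + 1)\<close>. The choice \<open>c = exp (pi / b)\<close> turns
  \<open>h t a b\<close> into \<open>f t - c * f (c * t)\<close>, since \<open>exp (a * pi / b) = c * c powr (a - 1)\<close>.
  The second term is \<open>f\<close> transported along the dilation \<open>t \<mapsto> c * t\<close> with its Jacobian, so its
  integral over \<open>{R..}\<close> is that of \<open>f\<close> over \<open>{c * R..}\<close>, and the two tails cancel except on
  \<open>{R..c * R}\<close> (\<open>dilation_difference_has_integral\<close>). This requires \<open>f\<close> to be integrable at
  infinity, which \<open>exp t\<close> in the denominator guarantees
  (\<open>fermi_integrand_absolutely_integrable\<close>).

  For the bounds, \<open>f\<close> is strictly decreasing, since for \<open>a < 1\<close> its numerator decreases while its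
  denominator increases, so its integral over \<open>{R..c * R}\<close> lies strictly between the length
  \<open>(c - 1) * R\<close> times \<open>f (c * R)\<close> and the same length times \<open>f R\<close>; these products are the stated expressions.
\<close>

text \<open>A Frullani-type cancellation. Integrability of \<open>f\<close> up to infinity is what makes the
  remaining tail vanish: \<open>f t = 1 / t\<close> gives \<open>0\<close> on the left but \<open>ln c\<close> on the right.\<close>

lemma dilation_difference_has_integral:
  fixes f :: "real \<Rightarrow> real"
  assumes f: "f absolutely_integrable_on {R..}" and R: "0 \<le> R" and c: "1 \<le> c"
  shows "((\<lambda>t. f t - c * f (c * t)) has_integral integral {R..c * R} f) {R..}"
proof -
  have le: "R \<le> c * R"
    using R c by (simp add: mult_le_cancel_right1)
  have img: "(\<lambda>t. c * t) ` {R..} = {c * R..}"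
    using c by (auto simp: image_iff field_simps intro!: bexI[where x = "x / c" for x])
  have tail: "f absolutely_integrable_on {c * R..}"
    using f le by (auto intro: set_integrable_subset)
  have "(\<lambda>t. \<bar>c\<bar> * f (c * t)) absolutely_integrable_on {R..} \<and>
        integral {R..} (\<lambda>t. \<bar>c\<bar> * f (c * t)) = integral {c * R..} f"
    using tail c
    by (subst has_absolute_integral_change_of_variables_1')
       (auto simp: img inj_on_def intro!: derivative_eq_intros)
  then have scaled: "((\<lambda>t. c * f (c * t)) has_integral integral {c * R..} f) {R..}"
    using c by (auto simp: has_integral_iff dest: set_lebesgue_integral_eq_integral(1))
  have "integral ({R..c * R} \<union> {c * R..}) f = integral {R..c * R} f + integral {c * R..} f"
  proof (rule integral_Un)
    show "f integrable_on {R..c * R}"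
      using absolutely_integrable_on_subinterval[OF f] by (auto simp: set_lebesgue_integral_eq_integral(1))
    show "f integrable_on {c * R..}"
      using tail by (rule set_lebesgue_integral_eq_integral(1))
    have "{R..c * R} \<inter> {c * R..} = {c * R}"
      using le by auto
    then show "negligible ({R..c * R} \<inter> {c * R..})"
      by simp
  qed
  moreover have "{R..c * R} \<union> {c * R..} = {R..}"
    using le by auto
  ultimately have "integral {R..} f - integral {c * R..} f = integral {R..c * R} f"
    by simp
  moreover have "(f has_integral integral {R..} f) {R..}"
    using set_lebesgue_integral_eq_integral(1)[OF f] by (rule integrable_integral)
  ultimately show ?thesis
    using has_integral_diff[OF _ scaled] by metis
qed

text \<open>For \<open>t \<ge> R\<close> and \<open>a \<le> 1\<close> the power is at most \<open>R powr (a - 1)\<close>, which leaves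
  \<open>exp (- t)\<close> as the dominating function.\<close>

lemma fermi_integrand_absolutely_integrable:
  fixes a R :: real
  assumes a: "a \<le> 1" and R: "0 < R"
  shows "(\<lambda>t. t powr (a - 1) / (exp t + 1)) absolutely_integrable_on {R..}"
proof (rule measurable_bounded_by_integrable_imp_absolutely_integrable)
  have "exp t + 1 \<noteq> 0" for t :: real
    by (smt (verit) exp_gt_zero)
  then show "(\<lambda>t. t powr (a - 1) / (exp t + 1)) \<in> borel_measurable (lebesgue_on {R..})"
    using R by (intro continuous_imp_measurable_on_sets_lebesgue continuous_intros) auto
  show "(\<lambda>t. R powr (a - 1) * exp (- 1 * t)) integrable_on {R..}"
    by (intro integrable_on_mult_right integrable_on_exp_minus_to_infinity) simp
  show "norm (t powr (a - 1) / (exp t + 1)) \<le> R powr (a - 1) * exp (- 1 * t)"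
    if "t \<in> {R..}" for t
  proof -
    have "t powr (a - 1) \<le> R powr (a - 1)"
      using a R that by (intro powr_mono2') auto
    then have "t powr (a - 1) / (exp t + 1) \<le> R powr (a - 1) / exp t"
      by (intro frac_le) auto
    then show ?thesis
      by (simp add: exp_minus divide_inverse abs_mult)
  qed
qed auto

lemma fermi_integrand_strict_antimono:
  fixes a s t :: real
  assumes "a \<le> 1" "0 < s" "s < t"
  shows "t powr (a - 1) / (exp t + 1) < s powr (a - 1) / (exp s + 1)"
proof (rule frac_less2)
  show "t powr (a - 1) \<le> s powr (a - 1)"
    using assms by (intro powr_mono2') auto
qed (use assms in \<open>auto intro: add_pos_pos\<close>)

text \<open>Each of the two endpoint values meets \<open>f\<close> at a single point, so the comparison of integrals
  with a constant integrand is strict in both directions.\<close>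

lemma integral_bounds_strict_antimono:
  fixes f :: "real \<Rightarrow> real"
  assumes cont: "continuous_on {r..s} f" and "r < s"
    and anti: "\<And>x y. \<lbrakk>r \<le> x; x < y; y \<le> s\<rbrakk> \<Longrightarrow> f y < f x"
  shows "(s - r) * f s < integral {r..s} f" and "integral {r..s} f < (s - r) * f r"
proof -
  have "integral {r..s} (\<lambda>_. f s) < integral {r..s} f"
    using assms by (intro integral_less_real) auto
  then show "(s - r) * f s < integral {r..s} f"
    using \<open>r < s\<close> by simp
  have "integral {r..s} f < integral {r..s} (\<lambda>_. f r)"
    using assms by (intro integral_less_real) auto
  then show "integral {r..s} f < (s - r) * f r"
    using \<open>r < s\<close> by simp
qed

theorem theorem7:
  fixes a b R c :: real
  assumes "0 < a" and "a < 1" and "b > 0" and "R \<ge> 1"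
    and "c = exp (pi / b)"
  shows "(\<lambda>t. h t a b) integrable_on {R..}
    \<and> integral {R..} (\<lambda>t. h t a b)
        = integral {R..c * R} (\<lambda>t. t powr (a - 1) / (exp t + 1))
    \<and> (c - 1) * (c powr (a - 1) * R powr a / (exp (c * R) + 1))
        < integral {R..} (\<lambda>t. h t a b)
    \<and> integral {R..} (\<lambda>t. h t a b) < (c - 1) * (R powr a / (exp R + 1))"
proof -
  define f where "f = (\<lambda>t::real. t powr (a - 1) / (exp t + 1))"
  have c: "1 < c"
    using assms by simp
  have R: "0 < R" "R < c * R"
    using assms c by auto
  have "exp (a * pi / b) = c powr a"
    using assms by (simp add: powr_def)
  also have "\<dots> = c * c powr (a - 1)"
    using c by (simp add: powr_mult_base)
  finally have h_eq: "h t a b = f t - c * f (c * t)" if "t \<in> {R..}" for t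
    using that R c assms(5) by (simp add: h_def f_def powr_mult mult_ac)
  have "((\<lambda>t. f t - c * f (c * t)) has_integral integral {R..c * R} f) {R..}"
    using fermi_integrand_absolutely_integrable[of a R] assms(2) R c
    by (intro dilation_difference_has_integral) (auto simp: f_def)
  then have int: "((\<lambda>t. h t a b) has_integral integral {R..c * R} f) {R..}"
    by (subst has_integral_cong[OF h_eq])
  have cont: "continuous_on {R..c * R} f"
  proof -
    have "exp t + 1 \<noteq> 0" for t :: real
      by (smt (verit) exp_gt_zero)
    then show ?thesis
      unfolding f_def using R by (intro continuous_intros) auto
  qed
  have anti: "f y < f x" if "R \<le> x" "x < y" for x y
    unfolding f_def using that assms(2) R by (intro fermi_integrand_strict_antimono) auto
  note bounds = integral_bounds_strict_antimono[OF cont R(2) anti]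
  have power: "R * R powr (a - 1) = R powr a"
    using R by (simp add: powr_mult_base)
  have "(c * R - R) * f (c * R) = (c - 1) * (c powr (a - 1) * (R * R powr (a - 1)) / (exp (c * R) + 1))"
    using R c by (simp add: f_def powr_mult field_simps)
  then have lower: "(c - 1) * (c powr (a - 1) * R powr a / (exp (c * R) + 1)) < integral {R..c * R} f"
    using bounds(1) by (simp add: power)
  have "(c * R - R) * f R = (c - 1) * (R * R powr (a - 1) / (exp R + 1))"
    by (simp add: f_def algebra_simps)
  then have upper: "integral {R..c * R} f < (c - 1) * (R powr a / (exp R + 1))"
    using bounds(2) by (simp add: power)
  show ?thesis
    using int lower upper by (auto simp: has_integral_iff f_def)
qed

end
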